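(* Let $n\ge 1$ and $k\ge 1$ be integers, and let $(S_{i,j})_{1\le i\le n,\,1\le j\le k}$ be an $(n,k)$-system. Then this $(n,k)$-system has a solution. Moreover, any solution $(p_{i,1})_{1\le i\le n}$ of the $(n,1)$-system $(S_{i,1})_{1\le i\le n}$ formed by its first column can be extended to a solution of the $(n,k)$-system; that is, there is a solution $(x_{i,j})_{1\le i\le n,\,1\le j\le k}$ of the $(n,k)$-system with $x_{i,1}=p_{i,1}$ for all $1\le i\le n$.
   Context: A sequence $(a_j)$ is a representative of a sequence of sets $(S_j)$ if $a_j\in S_j$ for each $j$. A representative $(x_j)$ of $(S_j)$ is regular if, for every $j$, $x_j\notin\{x_1,\dots,x_{j-1}\}$ whenever $S_j\setminus\{x_1,\dots,x_{j-1}\}$ has at least 2 elements. Two sequences $(a_1,a_2,\dots)$ and $(b_1,b_2,\dots)$ of the same length are compatible if $\{a_1,\dots,a_t\}\neq\{b_1,\dots,b_t\}$ (as sets) for all $t$. An $(n,k)$-system is an $n$-by-$k$ matrix whose entries are sets $S_{i,j}$, each of cardinality at least $n$. A solution of this system is an $n$-by-$k$ matrix with entries $x_{i,j}$ such that (1) each row $(x_{i,1},\dots,x_{i,k})$ is a regular representative of the corresponding row $(S_{i,1},\dots,S_{i,k})$ of the system, and (2) all rows are pairwise compatible (any two different rows $i\ne i'$ are compatible). *)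

theory Defs
  imports Main
begin

text \<open>
  Sequences of length \<open>k\<close> are functions on \<^typ>\<open>nat\<close> of which only the values at \<open>1, \<dots>, k\<close>
  matter; likewise an \<open>n\<close>-by-\<open>k\<close> matrix is a function of a row index in \<open>{1..n}\<close> and a column
  index in \<open>{1..k}\<close>.
\<close>

text \<open>The sets may be infinite, and \<^const>\<open>card\<close> is \<open>0\<close> on infinite sets.\<close>

definition card_at_least :: "nat \<Rightarrow> 'a set \<Rightarrow> bool" where
  "card_at_least m A \<longleftrightarrow> infinite A \<or> m \<le> card A"

definition representative :: "nat \<Rightarrow> (nat \<Rightarrow> 'a set) \<Rightarrow> (nat \<Rightarrow> 'a) \<Rightarrow> bool" where
  "representative k S x \<longleftrightarrow> (\<forall>j\<in>{1..k}. x j \<in> S j)"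

definition regular_representative :: "nat \<Rightarrow> (nat \<Rightarrow> 'a set) \<Rightarrow> (nat \<Rightarrow> 'a) \<Rightarrow> bool" where
  "regular_representative k S x \<longleftrightarrow>
     representative k S x \<and>
     (\<forall>j\<in>{1..k}. card_at_least 2 (S j - x ` {1..<j}) \<longrightarrow> x j \<notin> x ` {1..<j})"

text \<open>The empty prefix is excluded: it would make any two sequences incompatible.\<close>

definition compatible :: "nat \<Rightarrow> (nat \<Rightarrow> 'a) \<Rightarrow> (nat \<Rightarrow> 'a) \<Rightarrow> bool" where
  "compatible k a b \<longleftrightarrow> (\<forall>t\<in>{1..k}. a ` {1..t} \<noteq> b ` {1..t})"

definition nk_system :: "nat \<Rightarrow> nat \<Rightarrow> (nat \<Rightarrow> nat \<Rightarrow> 'a set) \<Rightarrow> bool" where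
  "nk_system n k S \<longleftrightarrow> (\<forall>i\<in>{1..n}. \<forall>j\<in>{1..k}. card_at_least n (S i j))"

definition solution ::
    "nat \<Rightarrow> nat \<Rightarrow> (nat \<Rightarrow> nat \<Rightarrow> 'a set) \<Rightarrow> (nat \<Rightarrow> nat \<Rightarrow> 'a) \<Rightarrow> bool" where
  "solution n k S x \<longleftrightarrow>
     (\<forall>i\<in>{1..n}. regular_representative k (S i) (x i)) \<and>
     (\<forall>i\<in>{1..n}. \<forall>i'\<in>{1..n}. i \<noteq> i' \<longrightarrow> compatible k (x i) (x i'))"

end

theory Submission
  imports Defs
begin

text \<open>
  The matrix is filled column by column and, within a column, row by row. Only the sets
  \<open>X i\<close> of elements that row \<open>i\<close> has used so far matter, and these have to stay distinct.
  Distinctness alone does not survive: for \<open>n = 6\<close> and all sets equal to a six-element set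
  \<open>U\<close>, the rows may reach the six sets \<open>U - {u, v}\<close> with \<open>u \<noteq> v\<close> from a fixed four-element
  subset \<open>V\<close> of \<open>U\<close>, and then the only possible successors are the four sets \<open>U - {v}\<close>
  with \<open>v \<in> V\<close>.

  The cure is a Hall-type condition, \<open>uncrowded\<close>: if the sets \<open>X i\<close> with \<open>i \<in> I\<close> have at most
  \<open>m\<close> elements, where \<open>m \<ge> n - 1\<close>, then \<open>card I + card (\<Inter>i\<in>I. X i) \<le> m + 1\<close>. In other
  words, few rows may contain a given large set; in the example above, all six rows
  contain the pair \<open>U - V\<close>, where four are allowed. As long as all sets are small, so that
  \<open>m = n - 1\<close>, the condition reads \<open>card I + card (\<Inter>i\<in>I. X i) \<le> n\<close>, which holds for
  distinct singletons if \<open>n \<ge> 2\<close>. Once two sets have the same size \<open>m \<ge> n - 1\<close>, it forces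
  them to be different, because \<open>2 + m > m + 1\<close>.

  The condition survives by uncrossing. The left-hand side is supermodular in \<open>I\<close>, so the
  sets of rows with equality that contain a given row \<open>i\<close> and in which \<open>i\<close> is not among the
  rows of maximal allowed size are closed under intersection (\<open>critical_Int\<close>). Adding \<open>s\<close> to
  \<open>X i\<close> breaks the condition only if \<open>s\<close> lies in \<open>X j\<close> for all other rows \<open>j\<close> of such a
  critical set. If two elements \<open>s\<close> and \<open>t\<close> were both harmful, the rows other than \<open>i\<close> in the
  intersection of their critical sets would have both \<open>s\<close> and \<open>t\<close> in common, which is
  one element too many (\<open>critical_element_unique\<close>). So all new elements but at most one
  preserve the condition, and counting shows that one of them also avoids all sets
  \<open>X j\<close> (\<open>extend_prefix\<close>). A row with at most one new element on offer repeats an old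
  element and changes nothing; for \<open>n \<ge> 2\<close> there is one.
\<close>

section \<open>Uncrowded families of sets\<close>

text \<open>
  The number \<open>m\<close> stands for \<open>max (n - 1) (Max {card (X i) | i. i \<in> I})\<close>. Quantifying over all
  upper bounds says the same without maxima and without subtraction on \<^typ>\<open>nat\<close>.
\<close>

definition uncrowded :: "nat \<Rightarrow> 'i set \<Rightarrow> ('i \<Rightarrow> 'a set) \<Rightarrow> bool" where
  "uncrowded n A X \<longleftrightarrow>
     (\<forall>I m. I \<subseteq> A \<longrightarrow> I \<noteq> {} \<longrightarrow> n \<le> Suc m \<longrightarrow> (\<forall>i\<in>I. card (X i) \<le> m) \<longrightarrow>
        card I + card (\<Inter>i\<in>I. X i) \<le> Suc m)"

text \<open>
  Equality together with \<open>card (X i) < m\<close> is the situation in which row \<open>i\<close> can grow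
  without raising the bound \<open>m\<close>, so that a larger intersection would be a violation.
\<close>

definition critical :: "nat \<Rightarrow> 'i set \<Rightarrow> ('i \<Rightarrow> 'a set) \<Rightarrow> 'i \<Rightarrow> 'i set \<Rightarrow> nat \<Rightarrow> bool" where
  "critical n A X i I m \<longleftrightarrow>
     I \<subseteq> A \<and> i \<in> I \<and> n \<le> Suc m \<and> (\<forall>j\<in>I. card (X j) \<le> m) \<and> card (X i) < m \<and>
     card I + card (\<Inter>j\<in>I. X j) = Suc m"

lemma uncrowdedD:
  assumes "uncrowded n A X" "I \<subseteq> A" "I \<noteq> {}" "n \<le> Suc m" "\<And>i. i \<in> I \<Longrightarrow> card (X i) \<le> m"
  shows "card I + card (\<Inter>i\<in>I. X i) \<le> Suc m"
  using assms unfolding uncrowded_def by blast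

lemma finite_INTER_member: "i \<in> I \<Longrightarrow> finite (X i) \<Longrightarrow> finite (\<Inter>j\<in>I. X j)"
  by (rule finite_subset[of _ "X i"]) auto

text \<open>
  Uncrossing: the larger bound \<open>m'\<close> serves for \<open>I \<union> J\<close> and the smaller one \<open>m\<close> for
  \<open>I \<inter> J\<close>. The sum of the two inequalities is attained by supermodularity, so both are
  equalities.
\<close>

lemma critical_Int:
  assumes A: "finite A" and fin: "\<And>j. j \<in> A \<Longrightarrow> finite (X j)" and unc: "uncrowded n A X"
    and I: "critical n A X i I m" and J: "critical n A X i J m'" and "m \<le> m'"
  shows "critical n A X i (I \<inter> J) m"
proof -
  let ?c = "\<lambda>I. \<Inter>j\<in>I. X j"
  have sub: "I \<subseteq> A" "J \<subseteq> A" "i \<in> I" "i \<in> J" and m: "n \<le> Suc m" "n \<le> Suc m'"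
    and bd: "\<And>j. j \<in> I \<Longrightarrow> card (X j) \<le> m" "\<And>j. j \<in> J \<Longrightarrow> card (X j) \<le> m'"
    and lt: "card (X i) < m"
    and eq: "card I + card (?c I) = Suc m" "card J + card (?c J) = Suc m'"
    using I J unfolding critical_def by auto
  have fc: "finite (?c I)" "finite (?c J)" "finite (?c (I \<inter> J))"
    using sub fin by (auto intro!: finite_INTER_member[of i])
  have un: "card (I \<union> J) + card (?c (I \<union> J)) \<le> Suc m'"
    using sub m bd \<open>m \<le> m'\<close> by (intro uncrowdedD[OF unc]) force+
  have int: "card (I \<inter> J) + card (?c (I \<inter> J)) \<le> Suc m"
    using sub m bd by (intro uncrowdedD[OF unc]) auto
  have rows: "card I + card J = card (I \<union> J) + card (I \<inter> J)"
    using sub A by (intro card_Un_Int) (auto intro: finite_subset)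
  have "card (?c I) + card (?c J) = card (?c I \<union> ?c J) + card (?c I \<inter> ?c J)"
    using fc by (intro card_Un_Int)
  also have "?c I \<inter> ?c J = ?c (I \<union> J)" by auto
  also have "card (?c I \<union> ?c J) \<le> card (?c (I \<inter> J))"
    using fc by (intro card_mono) auto
  finally have "card (I \<inter> J) + card (?c (I \<inter> J)) = Suc m"
    using rows un int eq by linarith
  then show ?thesis
    unfolding critical_def using sub m bd lt by auto
qed

text \<open>
  The rows other than \<open>i\<close> in \<open>I \<inter> J\<close> are one fewer than the critical set \<open>I \<inter> J\<close>, but they
  have \<open>s\<close> and \<open>t\<close> in common on top of the intersection over \<open>I \<inter> J\<close>. There is at least one
  such row, because \<open>{i}\<close> is never critical.
\<close>

lemma critical_element_unique:
  assumes A: "finite A" and fin: "\<And>j. j \<in> A \<Longrightarrow> finite (X j)" and unc: "uncrowded n A X"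
    and I: "critical n A X i I m" "\<And>j. j \<in> I - {i} \<Longrightarrow> s \<in> X j" "s \<notin> X i"
    and J: "critical n A X i J m'" "\<And>j. j \<in> J - {i} \<Longrightarrow> t \<in> X j" "t \<notin> X i"
  shows "s = t"
proof (rule ccontr)
  assume "s \<noteq> t"
  define l where "l = min m m'"
  define K where "K = I \<inter> J - {i}"
  have IJ: "critical n A X i (I \<inter> J) l"
  proof (cases "m \<le> m'")
    case True
    then show ?thesis
      using critical_Int[OF A fin unc I(1) J(1)] by (simp add: l_def min_absorb1)
  next
    case False
    then show ?thesis
      using critical_Int[OF A fin unc J(1) I(1)] by (simp add: l_def min_absorb2 Int_commute)
  qed
  have i: "i \<in> I \<inter> J" "I \<inter> J \<subseteq> A" and l: "n \<le> Suc l" "card (X i) < l"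
    and bd: "\<And>j. j \<in> I \<inter> J \<Longrightarrow> card (X j) \<le> l"
    and eq: "card (I \<inter> J) + card (\<Inter>j\<in>I \<inter> J. X j) = Suc l"
    using IJ unfolding critical_def by auto
  have finIJ: "finite (I \<inter> J)" using i A finite_subset by blast
  have ins: "I \<inter> J = insert i K" using i K_def by auto
  have cardK: "card (I \<inter> J) = Suc (card K)"
    unfolding K_def using finIJ i(1) by (rule card.remove)
  show False
  proof (cases "K = {}")
    case True
    then show False using eq ins l by simp
  next
    case False
    then obtain k where k: "k \<in> K" by blast
    have finK: "finite (\<Inter>j\<in>K. X j)"
      using k i fin by (intro finite_INTER_member[of k]) (auto simp: K_def)
    have finC: "finite (\<Inter>j\<in>I \<inter> J. X j)"
      using i fin by (intro finite_INTER_member[of i]) auto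
    have "card (insert s (insert t (\<Inter>j\<in>I \<inter> J. X j))) = card (\<Inter>j\<in>I \<inter> J. X j) + 2"
    proof -
      have "t \<notin> (\<Inter>j\<in>I \<inter> J. X j)" "s \<notin> insert t (\<Inter>j\<in>I \<inter> J. X j)"
        using i I(3) J(3) \<open>s \<noteq> t\<close> by auto
      then show ?thesis using finC by simp
    qed
    moreover have "insert s (insert t (\<Inter>j\<in>I \<inter> J. X j)) \<subseteq> (\<Inter>j\<in>K. X j)"
      using I(2) J(2) by (auto simp: K_def)
    ultimately have "card (\<Inter>j\<in>I \<inter> J. X j) + 2 \<le> card (\<Inter>j\<in>K. X j)"
      using card_mono[OF finK] by metis
    moreover have "card K + card (\<Inter>j\<in>K. X j) \<le> Suc l"
      using False i l bd by (intro uncrowdedD[OF unc]) (auto simp: K_def)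
    ultimately show False using eq cardK by linarith
  qed
qed

text \<open>
  A violation caused by adding one element is a violation by exactly one: an intersection
  over a set of rows containing \<open>i\<close> grew by the element \<open>s\<close>, and the bound on the sizes did
  not change.
\<close>

lemma crowding_insert_critical:
  assumes fin: "\<And>j. j \<in> A \<Longrightarrow> finite (X j)" and unc: "uncrowded n A X"
    and i: "i \<in> A" "s \<notin> X i" and crowded: "\<not> uncrowded n A (X(i := insert s (X i)))"
  obtains I m where "critical n A X i I m" "\<And>j. j \<in> I - {i} \<Longrightarrow> s \<in> X j"
proof -
  let ?X' = "X(i := insert s (X i))"
  obtain I m where I: "I \<subseteq> A" "I \<noteq> {}" "n \<le> Suc m"
    and bd': "\<And>j. j \<in> I \<Longrightarrow> card (?X' j) \<le> m"
    and viol: "Suc m < card I + card (\<Inter>j\<in>I. ?X' j)"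
    using crowded unfolding uncrowded_def not_le[symmetric] by blast
  have bd: "card (X j) \<le> m" if "j \<in> I" for j
    using bd'[OF that] i fin by (cases "j = i") auto
  have le: "card I + card (\<Inter>j\<in>I. X j) \<le> Suc m"
    using I bd by (intro uncrowdedD[OF unc])
  have "i \<in> I"
  proof (rule ccontr)
    assume "i \<notin> I"
    then have "(\<Inter>j\<in>I. ?X' j) = (\<Inter>j\<in>I. X j)" by (intro INF_cong) auto
    then show False using le viol by simp
  qed
  have finC: "finite (\<Inter>j\<in>I. X j)"
    using \<open>i \<in> I\<close> i fin by (intro finite_INTER_member[of i])
  have sub: "(\<Inter>j\<in>I. ?X' j) \<subseteq> insert s (\<Inter>j\<in>I. X j)"
    using \<open>i \<in> I\<close> by (auto split: if_splits)
  have "card (\<Inter>j\<in>I. ?X' j) \<le> card (insert s (\<Inter>j\<in>I. X j))"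
    using sub finC by (intro card_mono) auto
  also have "\<dots> \<le> Suc (card (\<Inter>j\<in>I. X j))" by (rule card_insert_le_m1) auto
  finally have eq: "card I + card (\<Inter>j\<in>I. X j) = Suc m" using viol le by linarith
  have "s \<in> X j" if "j \<in> I - {i}" for j
  proof (rule ccontr)
    assume "s \<notin> X j"
    then have "(\<Inter>j\<in>I. ?X' j) \<subseteq> (\<Inter>j\<in>I. X j)"
      using that sub by auto
    then have "card (\<Inter>j\<in>I. ?X' j) \<le> card (\<Inter>j\<in>I. X j)" using finC card_mono by blast
    then show False using viol eq by linarith
  qed
  moreover have "card (X i) < m"
    using bd'[OF \<open>i \<in> I\<close>] i fin by simp
  ultimately show thesis
    using that[of I m] I bd eq \<open>i \<in> I\<close> unfolding critical_def by blast
qed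

text \<open>
  At most one element of \<open>R\<close> violates the condition; collisions with other rows have to be
  excluded too. Sets of size at least \<open>n - 1\<close> cannot collide while the condition
  holds. For smaller \<open>X i\<close>, the rows that have reached a set of the form
  \<open>insert s (X i)\<close> all contain \<open>X i\<close>, so the condition allows at most
  \<open>n - 1 - card (X i)\<close> of them, fewer than \<open>card R\<close>. If exactly one element remains and that one
  violates the condition, then the colliding rows together with \<open>i\<close> form a critical set,
  which meets the critical set of the violation in \<open>i\<close> only: another contradiction.
\<close>

lemma extend_prefix:
  assumes A: "finite A" and fin: "\<And>j. j \<in> A \<Longrightarrow> finite (X j)" and unc: "uncrowded n A X"
    and i: "i \<in> A" and R: "finite R" "R \<inter> X i = {}" "2 \<le> card R" "n \<le> card (X i) + card R"
  obtains s where "s \<in> R" "uncrowded n A (X(i := insert s (X i)))"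
    "\<And>j. j \<in> A - {i} \<Longrightarrow> X j \<noteq> insert s (X i)"
proof -
  let ?X' = "\<lambda>s. X(i := insert s (X i))"
  \<comment> \<open>\<open>C\<close> collects the elements that cause a collision, \<open>B\<close> those that violate the condition.\<close>
  define C where "C = {s \<in> R. \<exists>j\<in>A - {i}. X j = insert s (X i)}"
  define B where "B = {s \<in> R. \<not> uncrowded n A (?X' s)}"
  have B_unique: "s = t" if s: "s \<in> B" and t: "t \<in> B" for s t
  proof -
    have st: "s \<notin> X i" "t \<notin> X i" "\<not> uncrowded n A (?X' s)" "\<not> uncrowded n A (?X' t)"
      using s t R by (auto simp: B_def)
    obtain I m where I: "critical n A X i I m" "\<And>j. j \<in> I - {i} \<Longrightarrow> s \<in> X j"
      using crowding_insert_critical[OF fin unc i st(1,3)] by blast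
    obtain J m' where J: "critical n A X i J m'" "\<And>j. j \<in> J - {i} \<Longrightarrow> t \<in> X j"
      using crowding_insert_critical[OF fin unc i st(2,4)] by blast
    show ?thesis
      using critical_element_unique[OF A fin unc I st(1) J st(2)] by blast
  qed
  have "\<exists>s\<in>R. s \<notin> B \<and> s \<notin> C"
  proof (cases "n \<le> Suc (card (X i))")
    case True
    have "C \<subseteq> B"
    proof
      fix s assume "s \<in> C"
      then obtain j where j: "j \<in> A" "j \<noteq> i" "X j = insert s (X i)" and "s \<in> R"
        by (auto simp: C_def)
      have "\<not> uncrowded n A (?X' s)"
      proof
        assume unc': "uncrowded n A (?X' s)"
        have "s \<notin> X i" using \<open>s \<in> R\<close> R by auto
        then have card: "card (insert s (X i)) = Suc (card (X i))" using fin i by simp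
        have "card {i, j} + card (\<Inter>l\<in>{i, j}. ?X' s l) \<le> Suc (card (insert s (X i)))"
          using i j True card by (intro uncrowdedD[OF unc']) auto
        then show False using j by simp
      qed
      then show "s \<in> B" using \<open>s \<in> R\<close> by (simp add: B_def)
    qed
    moreover have "\<not> R \<subseteq> B"
    proof
      assume "R \<subseteq> B"
      then have "card R \<le> 1"
        using B_unique R(1) by (auto simp: card_le_Suc0_iff_eq)
      then show False using R(3) by simp
    qed
    ultimately show ?thesis by blast
  next
    case False
    define m where "m = n - 1"
    have m: "Suc m = n" "card (X i) < m" using False by (auto simp: m_def)
    have "\<forall>s\<in>C. \<exists>j. j \<in> A - {i} \<and> X j = insert s (X i)" by (auto simp: C_def)
    from bchoice[OF this] obtain r
      where r: "\<And>s. s \<in> C \<Longrightarrow> r s \<in> A - {i} \<and> X (r s) = insert s (X i)"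
      by blast
    define T where "T = insert i (r ` C)"
    have CR: "C \<subseteq> R" by (auto simp: C_def)
    then have finC: "finite C" using R finite_subset by blast
    have new: "s \<notin> X i" if "s \<in> C" for s using that CR R by blast
    have inj: "inj_on r C"
      by (rule inj_onI) (metis new r insert_iff)
    have cardT: "card T = Suc (card C)"
    proof -
      have "i \<notin> r ` C" using r by blast
      then show ?thesis using finC inj by (simp add: T_def card_image)
    qed
    have T: "T \<subseteq> A" "i \<in> T" using i r by (auto simp: T_def)
    have bdT: "card (X j) \<le> m" if "j \<in> T" for j
      using that m r new fin i by (auto simp: T_def)
    have cap: "(\<Inter>j\<in>T. X j) = X i" using r by (auto simp: T_def)
    have le: "card T + card (X i) \<le> Suc m"
      using uncrowdedD[OF unc T(1), of m] T m bdT cap by auto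
    show ?thesis
    proof (rule ccontr)
      assume "\<not> ?thesis"
      then have "R \<subseteq> B \<union> C" by blast
      moreover have "card C < card R" using le cardT R(4) m by linarith
      ultimately obtain s where s: "s \<in> B" "s \<in> R" "s \<notin> C"
        using CR by (metis UnE less_irrefl subset_antisym subset_iff)
      have "R \<subseteq> insert s C" using \<open>R \<subseteq> B \<union> C\<close> B_unique[OF s(1)] by blast
      then have "card R \<le> Suc (card C)"
        using finC s card_mono[of "insert s C" R] by simp
      then have critT: "critical n A X i T m"
        using T bdT le m cardT R(4) cap unfolding critical_def by auto
      have st: "s \<notin> X i" "\<not> uncrowded n A (?X' s)" using s R by (auto simp: B_def)
      obtain I m' where I: "critical n A X i I m'" "\<And>j. j \<in> I - {i} \<Longrightarrow> s \<in> X j"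
        using crowding_insert_critical[OF fin unc i st] by blast
      have "m \<le> m'" using I(1) m by (auto simp: critical_def)
      then have "critical n A X i (T \<inter> I) m"
        using critical_Int[OF A fin unc critT I(1)] by blast
      moreover have "T \<inter> I = {i}"
      proof -
        have "r c \<notin> I" if "c \<in> C" for c
          using r[OF that] I(2)[of "r c"] st(1) s(3) that by auto
        then show ?thesis using I(1) by (auto simp: T_def critical_def)
      qed
      ultimately have "critical n A X i {i} m" by simp
      then show False by (auto simp: critical_def)
    qed
  qed
  then show thesis using that by (auto simp: B_def C_def)
qed

section \<open>Filling one column\<close>

definition spread_family :: "nat \<Rightarrow> (nat \<Rightarrow> 'a set) \<Rightarrow> bool" where
  "spread_family n X \<longleftrightarrow>
     (\<forall>i\<in>{1..n}. finite (X i)) \<and> inj_on X {1..n} \<and> uncrowded n {1..n} X"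

text \<open>
  The counting in \<open>extend_prefix\<close> needs finitely many candidates; from an infinite set any
  large enough finite part will do.
\<close>

lemma finite_subset_of_fresh_elements:
  assumes "card_at_least n S" "finite X" "card_at_least 2 (S - X)"
  obtains R where "R \<subseteq> S - X" "finite R" "2 \<le> card R" "n \<le> card X + card R"
proof (cases "finite S")
  case True
  then have "card S \<le> card (X \<union> (S - X))" using assms by (intro card_mono) auto
  also have "\<dots> \<le> card X + card (S - X)" by (rule card_Un_le)
  finally show thesis
    using that[of "S - X"] True assms by (auto simp: card_at_least_def)
next
  case False
  then have "infinite (S - X)" using assms by simp
  then obtain R where "R \<subseteq> S - X" "finite R" "card R = n + 2"
    using infinite_arbitrarily_large by metis
  then show thesis using that by auto
qed

lemma spread_family_extend_row:
  assumes good: "spread_family n X" and i: "i \<in> {1..n}" and S: "card_at_least n S"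
  obtains c where "c \<in> S" "card_at_least 2 (S - X i) \<Longrightarrow> c \<notin> X i"
    "spread_family n (X(i := insert c (X i)))"
proof -
  have fin: "\<And>j. j \<in> {1..n} \<Longrightarrow> finite (X j)" and inj: "inj_on X {1..n}"
    and unc: "uncrowded n {1..n} X"
    using good by (auto simp: spread_family_def)
  show thesis
  proof (cases "card_at_least 2 (S - X i)")
    case True
    obtain R where R: "R \<subseteq> S - X i" "finite R" "2 \<le> card R" "n \<le> card (X i) + card R"
      using finite_subset_of_fresh_elements[OF S fin[OF i] True] .
    moreover have "R \<inter> X i = {}" using R by blast
    ultimately obtain c where c: "c \<in> R" "uncrowded n {1..n} (X(i := insert c (X i)))"
      "\<And>j. j \<in> {1..n} - {i} \<Longrightarrow> X j \<noteq> insert c (X i)"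
      using extend_prefix[OF finite_atLeastAtMost fin unc i] by metis
    have "inj_on (X(i := insert c (X i))) {1..n}"
    proof (rule inj_on_fun_updI[OF inj])
      have "insert c (X i) \<noteq> X i" using c(1) \<open>R \<inter> X i = {}\<close> by blast
      then show "insert c (X i) \<notin> X ` {1..n}" using c(3) by blast
    qed
    then have "spread_family n (X(i := insert c (X i)))"
      using c fin i by (auto simp: spread_family_def)
    then show thesis using that c(1) R(1) by blast
  next
    case few: False
    show thesis
    proof (cases "S \<inter> X i = {}")
      case False
      then obtain c where "c \<in> S" "c \<in> X i" by blast
      then show thesis using that[of c] few good by (simp add: insert_absorb)
    next
      case True
      then have "S - X i = S" by blast
      then have "finite S" "card S \<le> 1" "n \<le> card S"
        using few S by (auto simp: card_at_least_def)
      \<comment> \<open>All of \<open>S\<close> is new, and \<open>S\<close> has at most one element: there is a single row, and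
        a single row satisfies every condition on the family.\<close>
      then have n: "n = 1" and i1: "i = 1" using i by auto
      obtain c where c: "c \<in> S" using \<open>n \<le> card S\<close> n by fastforce
      have "spread_family n (X(i := insert c (X i)))"
        using fin i n i1
        by (auto simp: spread_family_def uncrowded_def subset_singleton_iff)
      then show thesis using that c few by blast
    qed
  qed
qed

lemma spread_family_cong:
  assumes "spread_family n X" and eq: "\<And>i. i \<in> {1..n} \<Longrightarrow> X i = Y i"
  shows "spread_family n Y"
proof -
  have "uncrowded n {1..n} Y"
    unfolding uncrowded_def
  proof (intro allI impI)
    fix I m assume I: "I \<subseteq> {1..n}" "I \<noteq> {}" "n \<le> Suc m" "\<forall>i\<in>I. card (Y i) \<le> m"
    then have "\<And>i. i \<in> I \<Longrightarrow> X i = Y i" using eq by blast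
    then show "card I + card (\<Inter>i\<in>I. Y i) \<le> Suc m"
      using assms(1) I uncrowdedD[of n "{1..n}" X I m] by (simp add: spread_family_def)
  qed
  moreover have "inj_on Y {1..n}"
    using assms(1) eq inj_on_cong[of "{1..n}" X Y] by (simp add: spread_family_def)
  ultimately show ?thesis using assms(1) eq by (simp add: spread_family_def)
qed

text \<open>
  The rows move one after the other, so that in between some rows are a column ahead. This
  does no harm, as the family is spread at every intermediate stage.
\<close>

lemma spread_family_extend_rows:
  assumes good: "spread_family n X" and S: "\<And>i. i \<in> {1..n} \<Longrightarrow> card_at_least n (S i)"
  obtains c where
    "\<And>i. i \<in> {1..n} \<Longrightarrow> c i \<in> S i \<and> (card_at_least 2 (S i - X i) \<longrightarrow> c i \<notin> X i)"
    "spread_family n (\<lambda>i. insert (c i) (X i))"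
proof -
  have "\<exists>c. (\<forall>i\<in>Q. c i \<in> S i \<and> (card_at_least 2 (S i - X i) \<longrightarrow> c i \<notin> X i)) \<and>
          spread_family n (\<lambda>i. if i \<in> Q then insert (c i) (X i) else X i)"
    if "Q \<subseteq> {1..n}" for Q
    using finite_subset[OF that finite_atLeastAtMost] that
  proof (induction Q rule: finite_induct)
    case empty
    then show ?case using good by simp
  next
    case (insert q Q)
    then obtain c where c: "\<And>i. i \<in> Q \<Longrightarrow>
        c i \<in> S i \<and> (card_at_least 2 (S i - X i) \<longrightarrow> c i \<notin> X i)"
      and good': "spread_family n (\<lambda>i. if i \<in> Q then insert (c i) (X i) else X i)"
      by auto
    have q: "q \<in> {1..n}" using insert.prems by simp
    obtain d where d: "d \<in> S q" "card_at_least 2 (S q - X q) \<Longrightarrow> d \<notin> X q"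
      "spread_family n ((\<lambda>i. if i \<in> Q then insert (c i) (X i) else X i)(q := insert d (X q)))"
      using spread_family_extend_row[OF good' q S[OF q]] \<open>q \<notin> Q\<close> by auto
    have "(\<lambda>i. if i \<in> Q then insert (c i) (X i) else X i)(q := insert d (X q)) =
          (\<lambda>i. if i \<in> insert q Q then insert ((c(q := d)) i) (X i) else X i)"
      using \<open>q \<notin> Q\<close> by (auto simp: fun_eq_iff)
    then show ?case
      using c d \<open>q \<notin> Q\<close> by (intro exI[of _ "c(q := d)"]) auto
  qed
  from this[of "{1..n}"] obtain c where c:
    "\<forall>i\<in>{1..n}. c i \<in> S i \<and> (card_at_least 2 (S i - X i) \<longrightarrow> c i \<notin> X i)"
    "spread_family n (\<lambda>i. if i \<in> {1..n} then insert (c i) (X i) else X i)"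
    by blast
  have "spread_family n (\<lambda>i. insert (c i) (X i))"
    using c(2) by (rule spread_family_cong) simp
  then show thesis using that c(1) by blast
qed

lemma spread_family_singletons:
  assumes "inj_on a {1..n}"
  shows "spread_family n (\<lambda>i. {a i})"
proof -
  have "uncrowded n {1..n} (\<lambda>i. {a i})"
    unfolding uncrowded_def
  proof (intro allI impI)
    fix I m assume I: "I \<subseteq> {1..n}" "I \<noteq> {}" "n \<le> Suc m" "\<forall>i\<in>I. card {a i} \<le> m"
    show "card I + card (\<Inter>i\<in>I. {a i}) \<le> Suc m"
    proof (cases "\<exists>i. I = {i}")
      case True
      then show ?thesis using I by auto
    next
      case False
      then obtain i j where "i \<in> I" "j \<in> I" "i \<noteq> j" using I(2) by blast
      moreover from this have "a i \<noteq> a j" using assms I(1) by (meson inj_onD subsetD)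
      ultimately have "(\<Inter>i\<in>I. {a i}) = {}" by auto
      then show ?thesis using card_mono[OF _ I(1)] I(3) by simp
    qed
  qed
  moreover have "inj_on (\<lambda>i. {a i}) {1..n}"
    using assms unfolding inj_on_def by blast
  ultimately show ?thesis by (simp add: spread_family_def)
qed

section \<open>Building a solution\<close>

lemma solution_Suc:
  assumes "k \<ge> 1" and sol: "solution n k S x"
    and c: "\<And>i. i \<in> {1..n} \<Longrightarrow> c i \<in> S i (Suc k) \<and>
      (card_at_least 2 (S i (Suc k) - x i ` {1..k}) \<longrightarrow> c i \<notin> x i ` {1..k})"
    and inj: "inj_on (\<lambda>i. insert (c i) (x i ` {1..k})) {1..n}"
  shows "solution n (Suc k) S (\<lambda>i. (x i)(Suc k := c i))"
proof -
  have prefix: "(x i)(Suc k := c i) ` {1..t} = x i ` {1..t}" if "t \<le> k" for i t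
    using that by (intro image_cong) auto
  have before: "(x i)(Suc k := c i) ` {1..<t} = x i ` {1..<t}" if "t \<le> Suc k" for i t
    using that by (intro image_cong) auto
  have full: "(x i)(Suc k := c i) ` {1..Suc k} = insert (c i) (x i ` {1..k})" for i
    by (auto simp: atLeastAtMostSuc_conv)
  have "regular_representative (Suc k) (S i) ((x i)(Suc k := c i))" if i: "i \<in> {1..n}" for i
    unfolding regular_representative_def representative_def ball_conj_distrib[symmetric]
  proof
    fix j assume j: "j \<in> {1..Suc k}"
    have reg: "regular_representative k (S i) (x i)" using sol i by (auto simp: solution_def)
    have until: "(x i)(Suc k := c i) ` {1..<j} = x i ` {1..<j}" using j by (intro before) auto
    show "((x i)(Suc k := c i)) j \<in> S i j \<and>
        (card_at_least 2 (S i j - (x i)(Suc k := c i) ` {1..<j}) \<longrightarrow>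
          ((x i)(Suc k := c i)) j \<notin> (x i)(Suc k := c i) ` {1..<j})"
    proof (cases "j = Suc k")
      case True
      then show ?thesis
        unfolding until using c[OF i] by (simp add: atLeastLessThanSuc_atLeastAtMost)
    next
      case False
      then have "j \<in> {1..k}" using j by auto
      then show ?thesis
        unfolding until using reg False
        by (simp add: regular_representative_def representative_def)
    qed
  qed
  moreover have "compatible (Suc k) ((x i)(Suc k := c i)) ((x j)(Suc k := c j))"
    if ij: "i \<in> {1..n}" "j \<in> {1..n}" "i \<noteq> j" for i j
    unfolding compatible_def
  proof
    fix t assume t: "t \<in> {1..Suc k}"
    show "(x i)(Suc k := c i) ` {1..t} \<noteq> (x j)(Suc k := c j) ` {1..t}"
    proof (cases "t = Suc k")
      case True
      then show ?thesis using inj_onD[OF inj _ ij(1,2)] ij(3) unfolding True full by blast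
    next
      case False
      then have "t \<in> {1..k}" using t by auto
      moreover have "compatible k (x i) (x j)" using sol ij by (auto simp: solution_def)
      ultimately show ?thesis using prefix[of t] by (simp add: compatible_def del: fun_upd_image)
    qed
  qed
  ultimately show ?thesis by (auto simp: solution_def)
qed

lemma solution_1_iff:
  "solution n 1 S p \<longleftrightarrow> (\<forall>i\<in>{1..n}. p i 1 \<in> S i 1) \<and> inj_on (\<lambda>i. p i 1) {1..n}"
  by (auto simp: solution_def regular_representative_def representative_def compatible_def
      inj_on_def)

lemma exists_distinct_representatives:
  assumes "\<And>i. i \<in> {1..n} \<Longrightarrow> card_at_least n (S i)"
  obtains a where "\<And>i. i \<in> {1..n} \<Longrightarrow> a i \<in> S i" "inj_on a {1..n}"
proof -
  \<comment> \<open>Greedily: fewer than \<open>n\<close> elements have been used before each choice.\<close>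
  have "\<exists>a. (\<forall>i\<in>{1..m}. a i \<in> S i) \<and> inj_on a {1..m}" if "m \<le> n" for m
    using that
  proof (induction m)
    case 0
    then show ?case by simp
  next
    case (Suc m)
    then obtain a where a: "\<forall>i\<in>{1..m}. a i \<in> S i" "inj_on a {1..m}" by auto
    have "\<not> S (Suc m) \<subseteq> a ` {1..m}"
    proof
      assume sub: "S (Suc m) \<subseteq> a ` {1..m}"
      then have "finite (S (Suc m))" using finite_subset by blast
      then have "n \<le> card (S (Suc m))"
        using assms[of "Suc m"] Suc.prems by (auto simp: card_at_least_def)
      also have "\<dots> \<le> card (a ` {1..m})" using sub by (intro card_mono) auto
      also have "\<dots> \<le> m" using card_image_le[of "{1..m}" a] by simp
      finally show False using Suc.prems by simp
    qed
    then obtain s where s: "s \<in> S (Suc m)" "s \<notin> a ` {1..m}" by blast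
    have split: "{1..Suc m} = insert (Suc m) {1..m}" by auto
    have "inj_on (a(Suc m := s)) {1..Suc m}"
      unfolding split
      using inj_on_fun_updI[OF a(2) s(2), of "Suc m"] s(2)
      by (simp add: inj_on_insert del: fun_upd_image)
    moreover have "\<forall>i\<in>{1..Suc m}. (a(Suc m := s)) i \<in> S i"
      unfolding split using a(1) s(1) by simp
    ultimately show ?case by blast
  qed
  then show thesis using that by blast
qed

theorem theorem1:
  fixes n k :: nat and S :: "nat \<Rightarrow> nat \<Rightarrow> 'a set"
  assumes "n \<ge> 1" and "k \<ge> 1" and "nk_system n k S"
  shows "(\<exists>x. solution n k S x) \<and>
         (\<forall>p. solution n 1 S p \<longrightarrow>
              (\<exists>x. solution n k S x \<and> (\<forall>i\<in>{1..n}. x i 1 = p i 1)))"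
proof -
  have big: "card_at_least n (S i j)" if "i \<in> {1..n}" "j \<in> {1..k}" for i j
    using assms(3) that by (auto simp: nk_system_def)
  have ext: "\<exists>x. solution n k S x \<and> (\<forall>i\<in>{1..n}. x i 1 = p i 1)" if p: "solution n 1 S p" for p
  proof -
    have "\<exists>x. solution n l S x \<and> (\<forall>i\<in>{1..n}. x i 1 = p i 1) \<and>
            spread_family n (\<lambda>i. x i ` {1..l})" if "1 \<le> l" "l \<le> k" for l
      using that
    proof (induction l rule: dec_induct)
      case base
      then show ?case
        using p spread_family_singletons[of "\<lambda>i. p i 1" n]
        by (intro exI[of _ p]) (simp add: solution_1_iff[unfolded One_nat_def])
    next
      case (step l)
      then obtain x where x: "solution n l S x" "\<forall>i\<in>{1..n}. x i 1 = p i 1"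
        "spread_family n (\<lambda>i. x i ` {1..l})"
        by auto
      have next_big: "card_at_least n (S i (Suc l))" if "i \<in> {1..n}" for i
        using big[OF that, of "Suc l"] step.prems by simp
      obtain c where c: "\<And>i. i \<in> {1..n} \<Longrightarrow> c i \<in> S i (Suc l) \<and>
          (card_at_least 2 (S i (Suc l) - x i ` {1..l}) \<longrightarrow> c i \<notin> x i ` {1..l})"
        and good: "spread_family n (\<lambda>i. insert (c i) (x i ` {1..l}))"
        using spread_family_extend_rows[OF x(3), of "\<lambda>i. S i (Suc l)", OF next_big] by blast
      have "solution n (Suc l) S (\<lambda>i. (x i)(Suc l := c i))"
        using solution_Suc[OF step.hyps(1) x(1) c] good by (auto simp: spread_family_def)
      moreover have full: "(x i)(Suc l := c i) ` {1..Suc l} = insert (c i) (x i ` {1..l})" for i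
        by (auto simp: atLeastAtMostSuc_conv)
      have "spread_family n (\<lambda>i. (x i)(Suc l := c i) ` {1..Suc l})"
        unfolding full by (rule good)
      moreover have "\<forall>i\<in>{1..n}. ((x i)(Suc l := c i)) 1 = p i 1"
        using x(2) step.hyps by simp
      ultimately show ?case by blast
    qed
    then show ?thesis using assms(2) by blast
  qed
  obtain a where "\<And>i. i \<in> {1..n} \<Longrightarrow> a i \<in> S i 1" "inj_on a {1..n}"
    using exists_distinct_representatives[of n "\<lambda>i. S i 1"] big assms(2) by auto
  then have "solution n 1 S (\<lambda>i _. a i)"
    unfolding solution_1_iff by blast
  then show ?thesis using ext by blast
qed

end
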